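(* Let $S$ be a numerical semigroup, let $d\in S$ be odd, let $S^*=S\setminus\{0\}$, and let $S\bowtie^d S^*$ be the numerical duplication of $S$ with respect to the ideal $S^*$ and $d$. Then: (i) If $d<2\min\mathrm{PF}(S)$, then $k[[S\bowtie^d S^*]]$ has maximal reduced type if and only if $m(S)>\mathrm{F}(S)$. (ii) If $d>2\min\mathrm{PF}(S)$, then $k[[S\bowtie^d S^*]]$ has maximal reduced type if and only if $m(S)-\mathrm{F}(S)\geq\frac{d+1}{2}-\min\mathrm{PF}(S)$.
   Context: $\mathbb{N}$ denotes the non-negative integers. A numerical semigroup is a submonoid $S$ of $(\mathbb{N},+)$ with $\mathbb{N}\setminus S$ finite. The multiplicity $m(S)$ is the smallest nonzero element of $S$. A pseudo-Frobenius number of $S$ is an integer $f\in\mathbb{Z}\setminus S$ with $f+s\in S$ for all $s\in S\setminus\{0\}$; $\mathrm{PF}(S)$ is the set of these. The Frobenius number $\mathrm{F}(S)$ is the largest element of $\mathbb{N}\setminus S$; it is the maximum element of $\mathrm{PF}(S)$. For an odd integer $d\in S$ and an ideal $E$ of $S$ (a subset $E\subseteq S$ with $S+E\subseteq E$), the numerical duplication of $S$ with respect to $E$ and $d$ is the numerical semigroup $S\bowtie^d E = 2\cdot S\cup(2\cdot E+d)$, where $2\cdot S=\{2s\mid s\in S\}$ and $2\cdot E+d=\{2e+d\mid e\in E\}$. Let $k$ be an algebraically closed field of characteristic zero. For $S$ with minimal generators $n_1,\ldots,n_e$, $R=k[[S]] := k[[t^{n_1},\ldots,t^{n_e}]]\subseteq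 k[[t]]$. The type, $\mathrm{type}(k[[S]])$, is the Cohen-Macaulay type of $k[[S]]$, which equals $|\mathrm{PF}(S)|$. With $K$ the quotient field of $R$, $\bar R$ its integral closure in $K$ and $\mathfrak{C}=(R:_K\bar R)$ the conductor ideal, the reduced type is $s(R)=\dim_k \frac{\mathfrak{C}+xR}{xR}$ with $x=t^{m(S)}$; it satisfies $1\le s(R)\le \mathrm{type}(R)$, and it is known to equal the number of integers in $[\mathrm{F}(S)-m(S)+1,\mathrm{F}(S)]\setminus S$. $R$ has maximal reduced type if $s(R)=\mathrm{type}(R)$. *)

theory Defs
  imports
    Complex_Main
    "HOL-Computational_Algebra.Computational_Algebra"
begin

section \<open>Numerical semigroups\<close>

definition numerical_semigroup :: "nat set \<Rightarrow> bool" where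
  "numerical_semigroup S \<longleftrightarrow>
     0 \<in> S \<and> (\<forall>a\<in>S. \<forall>b\<in>S. a + b \<in> S) \<and> finite (UNIV - S)"

definition sg_multiplicity :: "nat set \<Rightarrow> nat" where
  "sg_multiplicity S = (LEAST n. n \<in> S \<and> n \<noteq> 0)"

definition pseudo_frobenius :: "nat set \<Rightarrow> int set" where
  "pseudo_frobenius S =
     {f. f \<notin> int ` S \<and> (\<forall>s\<in>S - {0}. f + int s \<in> int ` S)}"

text \<open>Meaningful only for \<open>S \<noteq> UNIV\<close>; the convention \<open>F(\<nat>) = -1\<close> is not built in.\<close>

definition frobenius :: "nat set \<Rightarrow> int" where
  "frobenius S = int (Max (UNIV - S))"

definition numerical_duplication :: "nat set \<Rightarrow> nat set \<Rightarrow> nat \<Rightarrow> nat set" where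
  "numerical_duplication S E d = {2 * s | s. s \<in> S} \<union> {2 * e + d | e. e \<in> E}"

definition minimal_generators :: "nat set \<Rightarrow> nat set" where
  "minimal_generators S = {n \<in> S - {0}. \<forall>a\<in>S - {0}. \<forall>b\<in>S - {0}. n \<noteq> a + b}"


section \<open>The ring \<open>k[[S]]\<close>\<close>

text \<open>
  \<open>exponent_vectors G n\<close> indexes the monomials in the variables \<open>x\<^sub>g\<close>, \<open>g \<in> G\<close>, that become
  \<open>t\<^sup>n\<close> under \<open>x\<^sub>g \<mapsto> t\<^sup>g\<close>. It is finite if \<open>G\<close> is a finite set of positive numbers.
\<close>

definition exponent_vectors :: "nat set \<Rightarrow> nat \<Rightarrow> (nat \<Rightarrow> nat) set" where
  "exponent_vectors G n = {a. (\<forall>g. g \<notin> G \<longrightarrow> a g = 0) \<and> (\<Sum>g\<in>G. a g * g) = n}"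

text \<open>
  \<open>k[[S]]\<close> is the set of all values of power series in \<open>e\<close> variables (\<open>e\<close> the number of minimal
  generators, \<open>c\<close> the coefficient family) at \<open>x\<^sub>g = t\<^sup>g\<close>. It is placed inside
  the field \<open>k((t))\<close>, so that its quotient field is a subfield of the ambient type.
\<close>

definition semigroup_ring :: "nat set \<Rightarrow> 'k::field fls set" where
  "semigroup_ring S =
     {fps_to_fls (Abs_fps (\<lambda>n. \<Sum>a\<in>exponent_vectors (minimal_generators S) n. c a)) |
       c :: (nat \<Rightarrow> nat) \<Rightarrow> 'k. True}"


section \<open>Quotient field, integral closure, conductor\<close>

text \<open>In this section \<open>R\<close> is a subring of an ambient field.\<close>

definition quotient_field :: "'a::field set \<Rightarrow> 'a set" where
  "quotient_field R = {a / b | a b. a \<in> R \<and> b \<in> R \<and> b \<noteq> 0}"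

definition integral_over :: "'a::field set \<Rightarrow> 'a \<Rightarrow> bool" where
  "integral_over R z \<longleftrightarrow>
     (\<exists>p. lead_coeff p = 1 \<and> (\<forall>i. coeff p i \<in> R) \<and> poly p z = 0)"

definition integral_closure :: "'a::field set \<Rightarrow> 'a set" where
  "integral_closure R = {z \<in> quotient_field R. integral_over R z}"

definition conductor :: "'a::field set \<Rightarrow> 'a set" where
  "conductor R = {z \<in> quotient_field R. \<forall>w\<in>integral_closure R. z * w \<in> R}"

definition principal_ideal :: "'a::field set \<Rightarrow> 'a \<Rightarrow> 'a set" where
  "principal_ideal R x = {x * r | r. r \<in> R}"

text \<open>The nonunits of \<open>R\<close>; this is the maximal ideal if \<open>R\<close> is local.\<close>

definition nonunits :: "'a::field set \<Rightarrow> 'a set" where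
  "nonunits R = {r \<in> R. \<forall>s\<in>R. r * s \<noteq> 1}"


section \<open>Dimension of a quotient space\<close>

text \<open>
  For subspaces \<open>W \<subseteq> V\<close>, \<open>basis_modulo scale V W B\<close> says that the elements of \<open>B\<close> represent, without
  repetition, a basis of \<open>V / W\<close>.
\<close>

definition basis_modulo ::
    "('k::field \<Rightarrow> 'v::ab_group_add \<Rightarrow> 'v) \<Rightarrow> 'v set \<Rightarrow> 'v set \<Rightarrow> 'v set \<Rightarrow> bool" where
  "basis_modulo scale V W B \<longleftrightarrow>
     B \<subseteq> V \<and> V \<subseteq> module.span scale (W \<union> B) \<and>
     (\<forall>b\<in>B. b \<notin> module.span scale (W \<union> (B - {b})))"

definition quotient_dim ::
    "('k::field \<Rightarrow> 'v::ab_group_add \<Rightarrow> 'v) \<Rightarrow> 'v set \<Rightarrow> 'v set \<Rightarrow> nat" where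
  "quotient_dim scale V W = card (SOME B. basis_modulo scale V W B)"

definition fls_scale :: "'k::field \<Rightarrow> 'k fls \<Rightarrow> 'k fls" where
  "fls_scale c f = fls_const c * f"

lemma vector_space_fls_scale: "vector_space (fls_scale :: 'k::field \<Rightarrow> 'k fls \<Rightarrow> 'k fls)"
  by unfold_locales
    (simp_all add: fls_scale_def algebra_simps flip: fls_plus_const fls_const_mult_const)


section \<open>Type and reduced type\<close>

text \<open>
  For a one-dimensional Cohen-Macaulay local ring \<open>(R, \<mm>)\<close> with residue field \<open>k\<close> and a parameter \<open>x\<close>,
  the Cohen-Macaulay type is the \<open>k\<close>-dimension of the socle \<open>(xR :\<^sub>R \<mm>) / xR\<close> of \<open>R / xR\<close>; it does
  not depend on \<open>x\<close>.
\<close>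

definition cm_type :: "'k::field fls set \<Rightarrow> 'k fls \<Rightarrow> nat" where
  "cm_type R x =
     quotient_dim fls_scale
       {r \<in> R. \<forall>y\<in>nonunits R. y * r \<in> principal_ideal R x}
       (principal_ideal R x)"

definition reduced_type :: "'k::field fls set \<Rightarrow> 'k fls \<Rightarrow> nat" where
  "reduced_type R x =
     quotient_dim fls_scale
       {c + z | c z. c \<in> conductor R \<and> z \<in> principal_ideal R x}
       (principal_ideal R x)"

text \<open>\<open>k[[S]]\<close> has maximal reduced type; the field \<open>k\<close> is passed as a type argument.\<close>

definition maximal_reduced_type :: "'k::field itself \<Rightarrow> nat set \<Rightarrow> bool" where
  "maximal_reduced_type _ S \<longleftrightarrow>
     (let R = semigroup_ring S :: 'k fls set;
          x = fls_X ^ sg_multiplicity S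
      in reduced_type R x = cm_type R x)"

end

theory Submission
  imports Defs
begin

text \<open>
  Everything reduces to arithmetic of \<open>T = S \<bowtie>\<^sup>d S\<^sup>*\<close>. Write \<open>F\<close> and \<open>m\<close> for Frobenius number and
  multiplicity of a numerical semigroup \<open>S \<noteq> \<nat>\<close>.

  \<^item> Inside \<open>k((t))\<close> the ring \<open>k[[S]]\<close> consists of the series with exponents in \<open>S\<close>
    (\<open>semigroup_ring_eq_supported_on\<close>), and the ideals and fractional ideals that enter the two types are
    also given by a set of admissible exponents: \<open>t\<^sup>m k[[S]]\<close> by \<open>m + S\<close>, the maximal ideal by
    \<open>S \<setminus> {0}\<close>, the conductor by \<open>{n. n > F}\<close>. For sets of exponents \<open>B \<subseteq> A\<close> with \<open>A \<setminus> B\<close> finite, the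
    quotient of the two spaces of series has the dimension \<open>|A \<setminus> B|\<close>
    (\<open>quotient_dim_supported_on\<close>). Subtracting \<open>m\<close> from the exponents in \<open>A \<setminus> B\<close>, one finds that the
    type of \<open>k[[S]]\<close> counts the pseudo-Frobenius numbers, and that the reduced type counts the gaps
    greater than \<open>F - m\<close>.

  \<^item> Every gap \<open>f > F - m\<close> is a pseudo-Frobenius number, since \<open>f + s > F\<close> for all nonzero \<open>s \<in> S\<close>.
    So the reduced type is maximal if and only if conversely all pseudo-Frobenius numbers are
    greater than \<open>F - m\<close> (\<open>maximal_reduced_type_iff\<close>).

  \<^item> For the duplication, \<open>m(T) = 2 m(S)\<close>, \<open>F(T) = 2 F(S) + d\<close> and
    \<open>PF(T) = 2 PF(S) \<union> (2 PF(S) + d) \<union> {d}\<close>, so that \<open>min PF(T) = min (2 min PF(S)) d\<close>. The condition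
    \<open>min PF(T) > F(T) - m(T)\<close> is \<open>m(S) > F(S)\<close> if \<open>d\<close> is the smaller of the two numbers, and
    \<open>2 (m(S) - F(S)) > d - 2 min PF(S)\<close> if \<open>2 min PF(S)\<close> is. As \<open>d\<close> is odd, the latter is the inequality
    with \<open>(d + 1) / 2\<close>.
\<close>

unbundle fps_syntax

section \<open>Quotients by the kernel of a linear map\<close>

text \<open>
  A linear map on \<open>V\<close> with kernel \<open>W\<close> identifies \<open>V / W\<close> with its image, and so turns bases modulo \<open>W\<close>
  into ordinary bases.
\<close>

lemma basis_modulo_iff_basis_image:
  assumes lin: "Vector_Spaces.linear s1 s2 p"
    and V: "module.subspace s1 V"
    and W: "W = {v \<in> V. p v = 0}"
  shows "basis_modulo s1 V W B \<longleftrightarrow>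
    B \<subseteq> V \<and> inj_on p B \<and> \<not> module.dependent s2 (p ` B) \<and> p ` V \<subseteq> module.span s2 (p ` B)"
proof (cases "B \<subseteq> V")
  case True
  interpret p: Vector_Spaces.linear s1 s2 p by (fact lin)
  \<comment> \<open>Spans modulo \<open>W\<close> can be tested in the image; both conditions on \<open>B\<close> are instances of this.\<close>
  have *: "v \<in> p.vs1.span (W \<union> X) \<longleftrightarrow> p v \<in> p.vs2.span (p ` X)"
    if "v \<in> V" "X \<subseteq> V" for v X
  proof
    have "p ` (W \<union> X) \<subseteq> insert 0 (p ` X)" using W by auto
    then have "p ` p.vs1.span (W \<union> X) \<subseteq> p.vs2.span (p ` X)"
      by (metis p.span_image p.vs2.span_insert_0 p.vs2.span_mono)
    then show "p v \<in> p.vs2.span (p ` X)" if "v \<in> p.vs1.span (W \<union> X)"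
      using that by blast
  next
    assume "p v \<in> p.vs2.span (p ` X)"
    then obtain u where u: "u \<in> p.vs1.span X" "p v = p u"
      unfolding p.span_image by blast
    have "u \<in> V" using u(1) \<open>X \<subseteq> V\<close> V p.vs1.span_minimal by blast
    then have "v - u \<in> W"
      using that V u(2) by (simp add: W p.vs1.subspace_diff p.diff)
    moreover have "u \<in> p.vs1.span (W \<union> X)"
      using u(1) p.vs1.span_mono[of X "W \<union> X"] by blast
    ultimately have "(v - u) + u \<in> p.vs1.span (W \<union> X)"
      by (meson UnI1 p.vs1.span_add p.vs1.span_base)
    then show "v \<in> p.vs1.span (W \<union> X)" by simp
  qed
  have "V \<subseteq> p.vs1.span (W \<union> B) \<longleftrightarrow> p ` V \<subseteq> p.vs2.span (p ` B)"
    using * True by blast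
  moreover have "(\<forall>b\<in>B. b \<notin> p.vs1.span (W \<union> (B - {b}))) \<longleftrightarrow>
      (\<forall>b\<in>B. p b \<notin> p.vs2.span (p ` (B - {b})))"
    using *[where X = "B - {b}" for b] True by blast
  moreover have "(\<forall>b\<in>B. p b \<notin> p.vs2.span (p ` (B - {b}))) \<longleftrightarrow>
      inj_on p B \<and> \<not> p.vs2.dependent (p ` B)" (is "?L \<longleftrightarrow> ?R")
  proof
    assume L: ?L
    have inj: "inj_on p B"
    proof (rule inj_onI, rule ccontr)
      fix b c assume "b \<in> B" "c \<in> B" "p b = p c" "b \<noteq> c"
      then have "p b \<in> p ` (B - {b})" by auto
      then have "p b \<in> p.vs2.span (p ` (B - {b}))" by (rule p.vs2.span_base)
      then show False using L \<open>b \<in> B\<close> by blast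
    qed
    have "p ` (B - {b}) = p ` B - {p b}" if "b \<in> B" for b
      using inj that by (auto simp: inj_on_def)
    then show ?R using L inj by (auto simp: p.vs2.dependent_def)
  next
    assume R: ?R
    have "p ` (B - {b}) = p ` B - {p b}" if "b \<in> B" for b
      using R that by (auto simp: inj_on_def)
    then show ?L using R by (auto simp: p.vs2.dependent_def)
  qed
  ultimately show ?thesis
    using True by (simp add: basis_modulo_def) blast
qed (simp add: basis_modulo_def)

text \<open>
  \<^const>\<open>quotient_dim\<close> takes the cardinality of an arbitrarily chosen basis modulo \<open>W\<close>. Lifting a basis of
  the image shows that there is one; as all of them map bijectively to bases of the image, the
  choice does not matter.
\<close>

lemma quotient_dim_eq_dim_image:
  assumes lin: "Vector_Spaces.linear s1 s2 p"
    and V: "module.subspace s1 V"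
    and W: "W = {v \<in> V. p v = 0}"
  shows "quotient_dim s1 V W = vector_space.dim s2 (p ` V)"
proof -
  interpret p: Vector_Spaces.linear s1 s2 p by (fact lin)
  note iff = basis_modulo_iff_basis_image[OF lin V W]
  obtain C where C: "C \<subseteq> p ` V" "p.vs2.independent C" "p ` V \<subseteq> p.vs2.span C"
    by (rule p.vs2.basis_exists)
  obtain B where B: "B \<subseteq> V" "inj_on p B" "p ` B = C"
    using C(1) unfolding subset_image_inj by auto
  have "basis_modulo s1 V W B"
    unfolding iff using B C by simp
  then have "basis_modulo s1 V W (SOME B. basis_modulo s1 V W B)"
    by (rule someI)
  moreover have "card B = p.vs2.dim (p ` V)" if "basis_modulo s1 V W B" for B
  proof -
    have B: "B \<subseteq> V" "inj_on p B" "p.vs2.independent (p ` B)" "p ` V \<subseteq> p.vs2.span (p ` B)"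
      using that iff by simp_all
    then have "card (p ` B) = p.vs2.dim (p ` V)"
      by (intro p.vs2.basis_card_eq_dim) auto
    then show ?thesis using B(2) by (simp add: card_image)
  qed
  ultimately show ?thesis unfolding quotient_dim_def by blast
qed

section \<open>Laurent series with prescribed support\<close>

definition supported_on :: "int set \<Rightarrow> 'k::field fls set" where
  "supported_on A = {f. \<forall>n. f $$ n \<noteq> 0 \<longrightarrow> n \<in> A}"

interpretation fls: vector_space "fls_scale :: 'k::field \<Rightarrow> 'k fls \<Rightarrow> 'k fls"
  by (rule vector_space_fls_scale)

lemma fls_scale_nth [simp]: "fls_scale c f $$ n = c * f $$ n"
  by (simp add: fls_scale_def)

lemma supported_onD: "f \<in> supported_on A \<Longrightarrow> n \<notin> A \<Longrightarrow> f $$ n = 0"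
  by (auto simp: supported_on_def)

lemma subspace_supported_on: "fls.subspace (supported_on A)"
  unfolding fls.subspace_def supported_on_def by (auto, metis add_0)

lemma X_intpow_in_supported_on [simp]:
  "(fls_X_intpow n :: 'k::field fls) \<in> supported_on A \<longleftrightarrow> n \<in> A"
  by (auto simp: supported_on_def)

lemma X_pow_in_supported_on [simp]:
  "(fls_X ^ n :: 'k::field fls) \<in> supported_on A \<longleftrightarrow> int n \<in> A"
  by (auto simp: supported_on_def)

text \<open>
  Only finitely many exponents are admissible, so every such series is a finite combination of
  monomials.
\<close>

lemma dim_supported_on:
  assumes "finite D"
  shows "fls.dim (supported_on D :: 'k::field fls set) = card D"
proof -
  let ?X = "fls_X_intpow :: int \<Rightarrow> 'k fls"
  have inj: "inj_on ?X D"
  proof (rule inj_onI)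
    fix m n assume "?X m = ?X n"
    then have "?X m $$ n = ?X n $$ n" by simp
    then show "m = n" by (simp split: if_splits)
  qed
  have ind: "fls.independent (?X ` D)"
    unfolding fls.dependent_def
  proof safe
    fix n assume n: "n \<in> D" "?X n \<in> fls.span (?X ` D - {?X n})"
    have "?X ` D - {?X n} \<subseteq> supported_on (D - {n})" by auto
    then have "fls.span (?X ` D - {?X n}) \<subseteq> supported_on (D - {n})"
      by (rule fls.span_minimal[OF _ subspace_supported_on])
    with n show False by auto
  qed
  have span: "supported_on D \<subseteq> fls.span (?X ` D)"
  proof
    fix f :: "'k fls" assume f: "f \<in> supported_on D"
    have "f = (\<Sum>n\<in>D. fls_scale (f $$ n) (?X n))"
      using supported_onD[OF f] assms
      by (intro fls_eqI) (auto simp: fls_nth_sum if_distrib cong: if_cong)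
    also have "\<dots> \<in> fls.span (?X ` D)"
      by (intro fls.span_sum fls.span_scale fls.span_base) auto
    finally show "f \<in> fls.span (?X ` D)" .
  qed
  have "?X ` D \<subseteq> supported_on D" by auto
  from fls.basis_card_eq_dim[OF this span ind]
  have "card (?X ` D) = fls.dim (supported_on D :: 'k fls set)" .
  then show ?thesis using inj by (simp add: card_image)
qed

text \<open>
  Cutting a series down to its terms with exponent in \<open>A - B\<close> is a linear map whose kernel on
  \<open>supported_on A\<close> is \<open>supported_on B\<close>.
\<close>

lemma quotient_dim_supported_on:
  assumes "B \<subseteq> A" "finite (A - B)"
  shows "quotient_dim fls_scale (supported_on A :: 'k::field fls set) (supported_on B) = card (A - B)"
proof -
  define p :: "'k fls \<Rightarrow> 'k fls" where
    "p f = (\<Sum>n\<in>A - B. fls_scale (f $$ n) (fls_X_intpow n))" for f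
  have p_nth: "p f $$ n = (if n \<in> A - B then f $$ n else 0)" for f n
    using assms(2) by (simp add: p_def fls_nth_sum if_distrib cong: if_cong)
  have lin: "Vector_Spaces.linear fls_scale fls_scale p"
    unfolding module_hom_iff_linear[symmetric] module_hom_iff
    by (intro conjI allI fls.module_axioms fls_eqI) (auto simp: p_nth)
  have "supported_on B = {f \<in> supported_on A. p f = 0}"
  proof (intro set_eqI iffI)
    fix f :: "'k fls" assume "f \<in> supported_on B"
    then show "f \<in> {f \<in> supported_on A. p f = 0}"
      using assms(1) by (auto simp: supported_on_def fls_eq_iff p_nth)
  next
    fix f :: "'k fls" assume f: "f \<in> {f \<in> supported_on A. p f = 0}"
    then have "f $$ n = 0" if "n \<in> A - B" for n
      using p_nth[of f n] that by simp
    then show "f \<in> supported_on B"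
      using f by (auto simp: supported_on_def)
  qed
  note * = quotient_dim_eq_dim_image[OF lin subspace_supported_on this]
  have "p ` supported_on A = supported_on (A - B)"
  proof
    show "p ` supported_on A \<subseteq> supported_on (A - B)"
      by (auto simp: supported_on_def p_nth split: if_splits)
    show "supported_on (A - B) \<subseteq> p ` supported_on A"
    proof
      fix f :: "'k fls" assume f: "f \<in> supported_on (A - B)"
      then have "p f = f" "f \<in> supported_on A"
        by (auto simp: fls_eq_iff p_nth supported_on_def)
      then show "f \<in> p ` supported_on A" by (metis imageI)
    qed
  qed
  then show ?thesis using * dim_supported_on[OF assms(2)] by simp
qed

lemma supported_on_mult:
  assumes f: "f \<in> supported_on A" and g: "g \<in> supported_on B"
    and AB: "\<And>a b. a \<in> A \<Longrightarrow> b \<in> B \<Longrightarrow> a + b \<in> C"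
  shows "f * g \<in> supported_on C"
  unfolding supported_on_def
proof (intro CollectI allI impI)
  fix n assume "(f * g) $$ n \<noteq> 0"
  then obtain i where "f $$ i * g $$ (n - i) \<noteq> 0"
    unfolding fls_times_nth(2) by (meson sum.not_neutral_contains_not_neutral)
  then have "i \<in> A" "n - i \<in> B" using f g by (auto simp: supported_on_def)
  from AB[OF this] show "n \<in> C" by simp
qed

lemma supported_on_sum:
  "{f + g | f g. f \<in> supported_on A \<and> g \<in> supported_on B} = (supported_on (A \<union> B) :: 'k::field fls set)"
proof
  show "{f + g | f g. f \<in> supported_on A \<and> g \<in> supported_on B} \<subseteq> (supported_on (A \<union> B) :: 'k fls set)"
    by (auto simp: supported_on_def) (metis add_0)
  show "(supported_on (A \<union> B) :: 'k fls set) \<subseteq> {f + g | f g. f \<in> supported_on A \<and> g \<in> supported_on B}"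
  proof
    fix h :: "'k fls" assume h: "h \<in> supported_on (A \<union> B)"
    define f where "f = Abs_fls (\<lambda>n. if n \<in> A then h $$ n else 0)"
    have f: "f $$ n = (if n \<in> A then h $$ n else 0)" for n
      unfolding f_def by (rule nth_Abs_fls_lower_bound[of "fls_subdegree h"]) simp
    have "f \<in> supported_on A" "h - f \<in> supported_on B"
      using h by (auto simp: supported_on_def f split: if_splits)
    moreover have "h = f + (h - f)" by simp
    ultimately show "h \<in> {f + g | f g. f \<in> supported_on A \<and> g \<in> supported_on B}" by blast
  qed
qed

lemma principal_ideal_supported_on:
  "principal_ideal (supported_on A) (fls_X ^ m) = (supported_on ((+) (int m) ` A) :: 'k::field fls set)"
proof
  show "principal_ideal (supported_on A) (fls_X ^ m) \<subseteq> (supported_on ((+) (int m) ` A) :: 'k fls set)"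
    unfolding principal_ideal_def by (auto intro!: supported_on_mult[where A = "{int m}" and B = A])
  show "(supported_on ((+) (int m) ` A) :: 'k fls set) \<subseteq> principal_ideal (supported_on A) (fls_X ^ m)"
  proof
    fix f :: "'k fls" assume f: "f \<in> supported_on ((+) (int m) ` A)"
    have "fls_shift (int m) f \<in> supported_on A"
      using f by (fastforce simp: supported_on_def)
    moreover have "f = fls_X ^ m * fls_shift (int m) f"
      by (simp add: fls_X_power_times_conv_shift)
    ultimately show "f \<in> principal_ideal (supported_on A) (fls_X ^ m)"
      unfolding principal_ideal_def by blast
  qed
qed

section \<open>Numerical semigroups\<close>

lemma numerical_semigroup_add:
  "numerical_semigroup S \<Longrightarrow> a \<in> S \<Longrightarrow> b \<in> S \<Longrightarrow> a + b \<in> S"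
  by (simp add: numerical_semigroup_def)

lemma numerical_semigroup_mult:
  assumes "numerical_semigroup S" "a \<in> S"
  shows "n * a \<in> S"
  using assms by (induction n) (auto simp: numerical_semigroup_def)

lemma numerical_semigroup_eventually:
  assumes "numerical_semigroup S"
  shows "\<exists>c. \<forall>n\<ge>c. n \<in> S"
proof -
  have "finite (UNIV - S)" using assms by (simp add: numerical_semigroup_def)
  then obtain c where "\<forall>n \<in> UNIV - S. n < c" using finite_nat_set_iff_bounded by blast
  then have "\<forall>n\<ge>c. n \<in> S" by (meson DiffI UNIV_I leD)
  then show ?thesis ..
qed

lemma
  assumes "numerical_semigroup S"
  shows sg_multiplicity_in: "sg_multiplicity S \<in> S"
    and sg_multiplicity_pos: "sg_multiplicity S > 0"
    and sg_multiplicity_le: "s \<in> S \<Longrightarrow> s \<noteq> 0 \<Longrightarrow> sg_multiplicity S \<le> s"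
proof -
  obtain c where c: "\<forall>n\<ge>c. n \<in> S"
    using numerical_semigroup_eventually[OF assms] by blast
  have "Suc c \<in> S \<and> Suc c \<noteq> 0" using c by simp
  then have "sg_multiplicity S \<in> S \<and> sg_multiplicity S \<noteq> 0"
    unfolding sg_multiplicity_def by (rule LeastI)
  then show "sg_multiplicity S \<in> S" "sg_multiplicity S > 0" by auto
  show "s \<in> S \<Longrightarrow> s \<noteq> 0 \<Longrightarrow> sg_multiplicity S \<le> s"
    unfolding sg_multiplicity_def by (rule Least_le) simp
qed

lemma
  assumes "numerical_semigroup S" "S \<noteq> UNIV"
  shows frobenius_notin: "frobenius S \<notin> int ` S"
    and frobenius_nonneg: "frobenius S \<ge> 0"
    and frobenius_less: "frobenius S < n \<Longrightarrow> n \<in> int ` S"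
proof -
  have gaps: "finite (UNIV - S)" "UNIV - S \<noteq> {}"
    using assms by (auto simp: numerical_semigroup_def)
  show "frobenius S \<notin> int ` S"
    using Max_in[OF gaps] by (auto simp: frobenius_def)
  show nonneg: "frobenius S \<ge> 0" by (simp add: frobenius_def)
  assume n: "frobenius S < n"
  then have "Max (UNIV - S) < nat n" by (simp add: frobenius_def)
  then have "nat n \<in> S" using Max_ge[OF gaps(1)] by (meson DiffI UNIV_I leD)
  then show "n \<in> int ` S" using n nonneg by (intro image_eqI[of _ _ "nat n"]) auto
qed

text \<open>
  A pseudo-Frobenius number \<open>f < 0\<close> must satisfy \<open>f + m = 0\<close>, because \<open>f + m\<close> is an element of \<open>S\<close> below
  \<open>m\<close>. But then \<open>S\<close> is closed under subtracting \<open>m\<close> from nonzero elements, so \<open>m\<close> divides all of \<open>S\<close>;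
  hence \<open>m = 1\<close> and \<open>S = \<nat>\<close>.
\<close>

lemma pseudo_frobenius_bounds:
  assumes S: "numerical_semigroup S" "S \<noteq> UNIV" and f: "f \<in> pseudo_frobenius S"
  shows "0 < f" "f \<le> frobenius S"
proof -
  let ?m = "sg_multiplicity S"
  have f_notin: "f \<notin> int ` S" and f_add: "\<And>s. s \<in> S \<Longrightarrow> s \<noteq> 0 \<Longrightarrow> f + int s \<in> int ` S"
    using f by (auto simp: pseudo_frobenius_def)
  show "f \<le> frobenius S"
    using frobenius_less[OF S] f_notin by (meson not_le)
  show "0 < f"
  proof (rule ccontr)
    assume "\<not> 0 < f"
    moreover have "f \<noteq> 0" using f_notin S by (auto simp: numerical_semigroup_def)
    ultimately have "f < 0" by simp
    obtain t where t: "t \<in> S" "f + int ?m = int t"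
      using f_add[of ?m] sg_multiplicity_in[OF S(1)] sg_multiplicity_pos[OF S(1)] by auto
    have "t = 0"
      using sg_multiplicity_le[OF S(1) t(1)] t(2) \<open>f < 0\<close> by linarith
    then have f: "f = - int ?m" using t(2) by simp
    have dvd: "s \<in> S \<Longrightarrow> ?m dvd s" for s
    proof (induction s rule: less_induct)
      case (less s)
      show ?case
      proof (cases "s = 0")
        case False
        then obtain u where u: "u \<in> S" "int s = int u + int ?m"
          using f_add[OF less.prems] f by auto
        then have "s = u + ?m" by linarith
        then show ?thesis using u(1) less.IH[of u] sg_multiplicity_pos[OF S(1)] by simp
      qed simp
    qed
    obtain c where c: "\<forall>n\<ge>c. n \<in> S"
      using numerical_semigroup_eventually[OF S(1)] by blast
    \<comment> \<open>\<open>S\<close> contains two consecutive numbers.\<close>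
    have "?m dvd c" "?m dvd Suc c" using c by (auto intro!: dvd)
    then have "?m = 1" by (metis dvd_1_iff_1 dvd_add_right_iff Suc_eq_plus1 One_nat_def)
    then have "n \<in> S" for n
      using numerical_semigroup_mult[OF S(1) sg_multiplicity_in[OF S(1)], of n] by simp
    then show False using S(2) by blast
  qed
qed

lemma finite_pseudo_frobenius:
  assumes "numerical_semigroup S" "S \<noteq> UNIV"
  shows "finite (pseudo_frobenius S)"
  by (rule finite_subset[of _ "{0..frobenius S}"]) (use pseudo_frobenius_bounds[OF assms] in force, simp)

lemma gap_near_frobenius_in_pseudo_frobenius:
  assumes S: "numerical_semigroup S" "S \<noteq> UNIV"
    and f: "f \<notin> int ` S" "frobenius S - int (sg_multiplicity S) < f"
  shows "f \<in> pseudo_frobenius S"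
proof -
  have "f + int s \<in> int ` S" if "s \<in> S - {0}" for s
    using sg_multiplicity_le[OF S(1), of s] that f(2) by (intro frobenius_less[OF S]) auto
  then show ?thesis using f(1) by (simp add: pseudo_frobenius_def)
qed

lemma frobenius_eqI:
  assumes S: "numerical_semigroup S" "S \<noteq> UNIV"
    and g: "g \<notin> int ` S" "\<And>n. g < n \<Longrightarrow> n \<in> int ` S"
  shows "frobenius S = g"
  using frobenius_notin[OF S] frobenius_less[OF S, of g] g by (meson linorder_neqE)

lemma frobenius_in_pseudo_frobenius:
  assumes S: "numerical_semigroup S" "S \<noteq> UNIV"
  shows "frobenius S \<in> pseudo_frobenius S"
  using gap_near_frobenius_in_pseudo_frobenius[OF S frobenius_notin[OF S]] sg_multiplicity_pos[OF S(1)]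
  by simp

section \<open>The ring \<open>k[[S]]\<close> as a set of series\<close>

text \<open>
  If \<open>S\<close> contains all numbers from \<open>c\<close> on, then a number \<open>n > m + c\<close> is the sum of \<open>m\<close> and \<open>n - m\<close>, both
  nonzero elements of \<open>S\<close>. Finiteness matters, since the exponent sums in \<open>exponent_vectors\<close> are taken
  over the set of minimal generators.
\<close>

lemma finite_minimal_generators:
  assumes "numerical_semigroup S"
  shows "finite (minimal_generators S)"
proof -
  obtain c where c: "\<forall>n\<ge>c. n \<in> S"
    using numerical_semigroup_eventually[OF assms] by blast
  let ?m = "sg_multiplicity S"
  have "n \<le> ?m + c" if "n \<in> minimal_generators S" for n
  proof (rule ccontr)
    assume "\<not> n \<le> ?m + c"
    then have "n - ?m \<in> S - {0}" "n = ?m + (n - ?m)" using c by auto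
    moreover have "?m \<in> S - {0}"
      using sg_multiplicity_in[OF assms] sg_multiplicity_pos[OF assms] by simp
    ultimately show False using that unfolding minimal_generators_def by blast
  qed
  then have "minimal_generators S \<subseteq> {..?m + c}" by auto
  then show ?thesis by (rule finite_subset) simp
qed

lemma finite_exponent_vectors:
  assumes "finite G" "0 \<notin> G"
  shows "finite (exponent_vectors G n)"
proof (rule finite_subset)
  show "exponent_vectors G n \<subseteq> {a. \<forall>g. (g \<in> G \<longrightarrow> a g \<in> {..n}) \<and> (g \<notin> G \<longrightarrow> a g = 0)}"
  proof
    fix a assume a: "a \<in> exponent_vectors G n"
    have "a g \<le> n" if "g \<in> G" for g
    proof -
      have "a g * 1 \<le> a g * g" using that assms(2) by (intro mult_left_mono) (auto simp: Suc_le_eq intro: gr0I)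
      also have "\<dots> \<le> (\<Sum>g\<in>G. a g * g)"
        using assms(1) that by (intro member_le_sum) auto
      also have "\<dots> = n" using a by (simp add: exponent_vectors_def)
      finally show ?thesis by simp
    qed
    then show "a \<in> {a. \<forall>g. (g \<in> G \<longrightarrow> a g \<in> {..n}) \<and> (g \<notin> G \<longrightarrow> a g = 0)}"
      using a by (simp add: exponent_vectors_def)
  qed
qed (use assms(1) in \<open>intro finite_set_of_finite_funs, auto\<close>)

lemma exponent_vectors_nonempty_iff:
  assumes S: "numerical_semigroup S"
  shows "exponent_vectors (minimal_generators S) n \<noteq> {} \<longleftrightarrow> n \<in> S"
proof
  let ?G = "minimal_generators S"
  assume "exponent_vectors ?G n \<noteq> {}"
  then obtain a where a: "(\<Sum>g\<in>?G. a g * g) = n" by (auto simp: exponent_vectors_def)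
  have "(\<Sum>g\<in>H. a g * g) \<in> S" if "H \<subseteq> ?G" for H
    using that
  proof (induction H rule: infinite_finite_induct)
    case (insert g H)
    then have "a g * g \<in> S"
      using S numerical_semigroup_mult by (auto simp: minimal_generators_def)
    then show ?case using insert S by (simp add: numerical_semigroup_add)
  qed (use S in \<open>auto simp: numerical_semigroup_def\<close>)
  from this[OF order.refl] a show "n \<in> S" by simp
next
  let ?G = "minimal_generators S"
  note fin = finite_minimal_generators[OF S]
  assume "n \<in> S"
  then show "exponent_vectors ?G n \<noteq> {}"
  proof (induction n rule: less_induct)
    case (less n)
    consider "n = 0" | "n \<in> ?G" | a b where "a \<in> S - {0}" "b \<in> S - {0}" "n = a + b"
      using less.prems unfolding minimal_generators_def by blast
    then show ?case
    proof cases
      case 1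
      then have "(\<lambda>_. 0) \<in> exponent_vectors ?G n" by (simp add: exponent_vectors_def)
      then show ?thesis by blast
    next
      case 2
      have "(\<Sum>g\<in>?G. (if g = n then 1 else 0) * g) = (\<Sum>g\<in>?G. if g = n then n else 0)"
        by (intro sum.cong) auto
      then have "(\<lambda>g. if g = n then 1 else 0) \<in> exponent_vectors ?G n"
        using 2 fin by (auto simp: exponent_vectors_def)
      then show ?thesis by blast
    next
      case 3
      then have "a < n" "b < n" by auto
      then obtain u v where "u \<in> exponent_vectors ?G a" "v \<in> exponent_vectors ?G b"
        using less.IH 3 by blast
      then have "(\<lambda>g. u g + v g) \<in> exponent_vectors ?G n"
        using 3(3) by (simp add: exponent_vectors_def distrib_right sum.distrib)
      then show ?thesis by blast
    qed
  qed
qed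

text \<open>
  The \<open>n\<close>-th coefficient of a value of a power series in several variables is a sum over all ways of
  writing \<open>n\<close> in the generators. It vanishes for \<open>n \<notin> S\<close>, where there is no such way; for \<open>n \<in> S\<close> any value is
  attained by putting it on one chosen exponent vector.
\<close>

lemma semigroup_ring_eq_supported_on:
  assumes S: "numerical_semigroup S"
  shows "semigroup_ring S = (supported_on (int ` S) :: 'k::field fls set)"
proof -
  let ?E = "exponent_vectors (minimal_generators S)"
  have fin: "finite (?E n)" for n
    by (intro finite_exponent_vectors finite_minimal_generators S) (simp add: minimal_generators_def)
  show ?thesis
  proof
    show "semigroup_ring S \<subseteq> (supported_on (int ` S) :: 'k fls set)"
    proof
      fix f :: "'k fls" assume "f \<in> semigroup_ring S"
      then obtain c where f: "f = fps_to_fls (Abs_fps (\<lambda>n. \<Sum>a\<in>?E n. c a))"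
        unfolding semigroup_ring_def by blast
      show "f \<in> supported_on (int ` S)"
        unfolding supported_on_def
      proof (intro CollectI allI impI)
        fix n assume "f $$ n \<noteq> 0"
        then have "n \<ge> 0" "?E (nat n) \<noteq> {}" by (auto simp: f split: if_splits)
        then show "n \<in> int ` S"
          using exponent_vectors_nonempty_iff[OF S] by (intro image_eqI[of _ _ "nat n"]) auto
      qed
    qed
    show "(supported_on (int ` S) :: 'k fls set) \<subseteq> semigroup_ring S"
    proof
      fix f :: "'k fls" assume f: "f \<in> supported_on (int ` S)"
      \<comment> \<open>\<open>w n\<close> is the exponent vector that carries the whole coefficient of \<open>t\<^sup>n\<close>.\<close>
      define w where "w n = (SOME a. a \<in> ?E n)" for n
      have w: "w n \<in> ?E n" if "n \<in> S" for n
        unfolding w_def using that exponent_vectors_nonempty_iff[OF S, of n] by (simp add: some_in_eq)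
      define c where "c a = (let n = \<Sum>g\<in>minimal_generators S. a g * g in
        if a = w n then f $$ int n else 0)" for a
      have "(\<Sum>a\<in>?E n. c a) = f $$ int n" for n
      proof -
        have "(\<Sum>a\<in>?E n. c a) = (\<Sum>a\<in>?E n. if a = w n then f $$ int n else 0)"
          by (intro sum.cong) (auto simp: c_def exponent_vectors_def)
        also have "\<dots> = (if w n \<in> ?E n then f $$ int n else 0)"
          using fin by simp
        also have "\<dots> = f $$ int n"
          using w[of n] supported_onD[OF f, of "int n"] by (cases "n \<in> S") (auto simp: image_iff)
        finally show ?thesis .
      qed
      moreover have "f $$ n = 0" if "n < 0" for n
        using that by (intro supported_onD[OF f]) auto
      ultimately have "f = fps_to_fls (Abs_fps (\<lambda>n. \<Sum>a\<in>?E n. c a))"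
        by (intro fls_eqI) auto
      then show "f \<in> semigroup_ring S" unfolding semigroup_ring_def by blast
    qed
  qed
qed

text \<open>
  Multiplication with a high power of \<open>t\<close> moves any Laurent series beyond the last gap.
\<close>

lemma quotient_field_semigroup_ring:
  assumes S: "numerical_semigroup S"
  shows "quotient_field (supported_on (int ` S)) = (UNIV :: 'k::field fls set)"
proof -
  obtain c where c: "\<forall>n\<ge>c. n \<in> S"
    using numerical_semigroup_eventually[OF S] by blast
  have "z \<in> quotient_field (supported_on (int ` S))" for z :: "'k fls"
  proof -
    define N where "N = c + nat (- fls_subdegree z)"
    have "fls_X ^ N * z \<in> supported_on (int ` S)"
      unfolding supported_on_def
    proof (intro CollectI allI impI)
      fix n assume "(fls_X ^ N * z) $$ n \<noteq> 0"
      then have "z $$ (n - int N) \<noteq> 0" by (simp add: fls_X_power_times_conv_shift)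
      then have "fls_subdegree z \<le> n - int N" by (rule fls_subdegree_leI)
      then have "n \<ge> int c" unfolding N_def by linarith
      then show "n \<in> int ` S" using c by (intro image_eqI[of _ _ "nat n"]) auto
    qed
    moreover have "(fls_X ^ N :: 'k fls) \<in> supported_on (int ` S)"
      unfolding X_pow_in_supported_on using c by (intro imageI) (simp add: N_def)
    moreover have "z = (fls_X ^ N * z) / fls_X ^ N"
      by (rule nonzero_mult_div_cancel_left[symmetric]) simp
    moreover have "(fls_X ^ N :: 'k fls) \<noteq> 0" by simp
    ultimately show ?thesis unfolding quotient_field_def by blast
  qed
  then show ?thesis by blast
qed

text \<open>
  If \<open>w\<close> has the negative subdegree \<open>v\<close>, then in a monic polynomial of degree \<open>N\<close> at \<open>w\<close> the leading term
  has subdegree \<open>N v\<close>, strictly below that of all others, so it cannot cancel.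
\<close>

lemma integral_over_power_series_imp_power_series:
  assumes R: "R \<subseteq> (supported_on {0..} :: 'k::field fls set)" and w: "integral_over R w"
  shows "w \<in> supported_on {0..}"
proof (rule ccontr)
  assume neg: "w \<notin> supported_on {0..}"
  define v where "v = fls_subdegree w"
  have "v < 0" "w \<noteq> 0"
    using neg fls_subdegree_leI[of w] by (force simp: supported_on_def v_def)+
  obtain p where p: "lead_coeff p = 1" "\<And>i. coeff p i \<in> R" "poly p w = 0"
    using w unfolding integral_over_def by blast
  define N where "N = degree p"
  have lower: "(coeff p i * w ^ i) $$ (int N * v) = 0" if "i < N" for i
  proof -
    have "w ^ i \<in> supported_on {int i * v..}"
      using fls_subdegree_leI[of "w ^ i"] by (auto simp: supported_on_def fls_subdegree_pow v_def)
    then have "coeff p i * w ^ i \<in> supported_on {int i * v..}"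
      using p(2)[of i] R by (intro supported_on_mult[where A = "{0..}"]) auto
    moreover have "int N * v < int i * v" using that \<open>v < 0\<close> by simp
    ultimately show ?thesis by (intro supported_onD) auto
  qed
  have "poly p w = (\<Sum>i<N. coeff p i * w ^ i) + w ^ N"
    using p(1) unfolding poly_altdef N_def lessThan_Suc_atMost[symmetric] by simp
  then have "poly p w $$ (int N * v) = (w ^ N) $$ (int N * v)"
    using lower by (simp add: fls_nth_sum)
  moreover have "(w ^ N) $$ (int N * v) \<noteq> 0"
    using \<open>w \<noteq> 0\<close> nth_fls_subdegree_nonzero[of "w ^ N"] by (simp add: fls_subdegree_pow v_def)
  ultimately show False using p(3) by simp
qed

text \<open>
  \<open>t\<^sup>n\<close> is a root of \<open>Y\<^sup>m - t\<^sup>n\<^sup>m\<close>. These elements of the integral closure, and the fact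
  that it consists of power series, suffice to find the conductor.
\<close>

lemma X_pow_in_integral_closure:
  assumes S: "numerical_semigroup S"
  shows "(fls_X ^ n :: 'k::field fls) \<in> integral_closure (supported_on (int ` S))"
proof -
  let ?m = "sg_multiplicity S" and ?R = "supported_on (int ` S) :: 'k fls set"
  let ?q = "[:- (fls_X ^ (n * ?m)):] :: 'k fls poly"
  let ?p = "monom 1 ?m + ?q"
  have m: "?m > 0" "n * ?m \<in> S"
    using sg_multiplicity_pos sg_multiplicity_in numerical_semigroup_mult S by auto
  have deg: "degree ?q < degree (monom (1 :: 'k fls) ?m)" using m by (simp add: degree_monom_eq)
  have "lead_coeff ?p = 1"
    using deg by (simp only: lead_coeff_add_le degree_add_eq_left) (use m in \<open>simp add: degree_monom_eq coeff_pCons split: nat.splits\<close>)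
  moreover have "coeff ?p i \<in> ?R" for i
  proof -
    have coeff: "coeff ?p i = (if i = ?m then 1 else if i = 0 then - (fls_X ^ (n * ?m)) else 0)"
      using m by (auto simp: coeff_pCons split: nat.splits)
    have "fls_X ^ (n * ?m) \<in> ?R"
      using m(2) unfolding X_pow_in_supported_on by (rule imageI)
    then have "- (fls_X ^ (n * ?m)) \<in> ?R"
      by (rule fls.subspace_neg[OF subspace_supported_on])
    moreover have "1 \<in> ?R" using S by (auto simp: supported_on_def numerical_semigroup_def)
    moreover have "0 \<in> ?R" by (rule fls.subspace_0[OF subspace_supported_on])
    ultimately show ?thesis unfolding coeff by (simp only: split: if_split) blast
  qed
  moreover have "poly ?p (fls_X ^ n) = 0"
    by (simp add: poly_monom power_mult)
  ultimately have "integral_over ?R (fls_X ^ n)" unfolding integral_over_def by blast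
  then show ?thesis
    by (simp add: integral_closure_def quotient_field_semigroup_ring[OF S])
qed

text \<open>
  A series with a nonzero coefficient at some \<open>n \<le> F\<close> leaves \<open>k[[S]]\<close> upon multiplication with
  \<open>t\<^sup>F\<^sup>-\<^sup>n\<close>, as \<open>F \<notin> S\<close>. Conversely a power series times a series beyond \<open>F\<close> stays beyond \<open>F\<close>.
\<close>

lemma conductor_semigroup_ring:
  assumes S: "numerical_semigroup S" "S \<noteq> UNIV"
  shows "conductor (supported_on (int ` S)) = (supported_on {frobenius S<..} :: 'k::field fls set)"
proof (intro set_eqI iffI)
  let ?R = "supported_on (int ` S) :: 'k fls set"
  fix z :: "'k fls" assume z: "z \<in> conductor ?R"
  show "z \<in> supported_on {frobenius S<..}"
    unfolding supported_on_def
  proof (intro CollectI allI impI, rule ccontr)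
    fix n assume n: "z $$ n \<noteq> 0" "n \<notin> {frobenius S<..}"
    define i where "i = nat (frobenius S - n)"
    have "fls_X ^ i * z \<in> ?R"
      using z X_pow_in_integral_closure[OF S(1), where 'k = 'k]
      unfolding conductor_def mult.commute[of _ z] by blast
    moreover have "(fls_X ^ i * z) $$ frobenius S \<noteq> 0"
      using n by (simp add: fls_X_power_times_conv_shift i_def)
    ultimately show False
      using frobenius_notin[OF S] by (auto simp: supported_on_def)
  qed
next
  let ?R = "supported_on (int ` S) :: 'k fls set"
  fix z :: "'k fls" assume z: "z \<in> supported_on {frobenius S<..}"
  have R: "?R \<subseteq> supported_on {0..}" by (auto simp: supported_on_def)
  have "z * w \<in> ?R" if "w \<in> integral_closure ?R" for w
  proof -
    have "w \<in> supported_on {0..}"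
      using that integral_over_power_series_imp_power_series[OF R] by (simp add: integral_closure_def)
    with z show ?thesis
      by (rule supported_on_mult) (auto intro!: frobenius_less[OF S])
  qed
  then show "z \<in> conductor ?R"
    by (simp add: conductor_def quotient_field_semigroup_ring[OF S(1)])
qed

text \<open>
  The recursion for the coefficients of the inverse expresses the \<open>n\<close>-th one by products of an \<open>i\<close>-th
  coefficient of \<open>y\<close> and an \<open>(n - i)\<close>-th one of the inverse. By induction a nonzero product has
  \<open>i \<in> S\<close> and \<open>n - i \<in> S\<close>, so the support of the inverse stays in \<open>S\<close>.
\<close>

lemma inverse_in_semigroup_ring:
  assumes S: "numerical_semigroup S" and y: "(y :: 'k::field fls) \<in> supported_on (int ` S)"
    and y0: "y $$ 0 \<noteq> 0"
  obtains s where "s \<in> supported_on (int ` S)" "y * s = 1"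
proof -
  define g where "g = fls_regpart y"
  have "fls_subdegree y \<ge> 0"
    by (intro fls_subdegree_ge0I supported_onD[OF y]) auto
  then have yg: "y = fps_to_fls g" by (simp add: g_def)
  have unit: "g * inverse g = 1" using y0 by (simp add: inverse_mult_eq_1' g_def)
  have g: "n \<in> S" if "g $ n \<noteq> 0" for n
    using that y by (auto simp: g_def supported_on_def)
  have inv: "inverse g $ n \<noteq> 0 \<Longrightarrow> n \<in> S" for n
  proof (induction n rule: less_induct)
    case (less n)
    show ?case
    proof (cases "n = 0")
      case True
      then show ?thesis using S by (simp add: numerical_semigroup_def)
    next
      case False
      have "0 = (g * inverse g) $ n" using False unit by simp
      also have "\<dots> = g $ 0 * inverse g $ n + (\<Sum>i=1..n. g $ i * inverse g $ (n - i))"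
        by (simp add: fps_mult_nth sum.atLeast_Suc_atMost)
      finally have "(\<Sum>i=1..n. g $ i * inverse g $ (n - i)) \<noteq> 0"
        using less.prems y0 by (auto simp: g_def)
      then obtain i where i: "i \<in> {1..n}" "g $ i * inverse g $ (n - i) \<noteq> 0"
        by (meson sum.not_neutral_contains_not_neutral)
      then have "i \<in> S" "n - i \<in> S" using g less.IH[of "n - i"] by auto
      then have "i + (n - i) \<in> S" by (rule numerical_semigroup_add[OF S])
      then show ?thesis using i by simp
    qed
  qed
  have "fps_to_fls (inverse g) \<in> supported_on (int ` S)"
    unfolding supported_on_def
  proof (intro CollectI allI impI)
    fix n assume "fps_to_fls (inverse g) $$ n \<noteq> 0"
    then have "n \<ge> 0" "nat n \<in> S" using inv by (auto split: if_splits)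
    then show "n \<in> int ` S" by (intro image_eqI[of _ _ "nat n"]) auto
  qed
  moreover have "y * fps_to_fls (inverse g) = 1"
    unfolding yg fls_times_fps_to_fls[symmetric] unit by simp
  ultimately show ?thesis by (rule that)
qed

lemma nonunits_semigroup_ring:
  assumes S: "numerical_semigroup S"
  shows "nonunits (supported_on (int ` S)) = (supported_on (int ` (S - {0})) :: 'k::field fls set)"
proof (intro set_eqI iffI)
  fix y :: "'k fls" assume y: "y \<in> nonunits (supported_on (int ` S))"
  then have "y \<in> supported_on (int ` S)" "y $$ 0 = 0"
    using inverse_in_semigroup_ring[OF S] unfolding nonunits_def by blast+
  then show "y \<in> supported_on (int ` (S - {0}))"
    unfolding supported_on_def by fastforce
next
  fix y :: "'k fls" assume y: "y \<in> supported_on (int ` (S - {0}))"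
  have "y * s \<noteq> 1" if "s \<in> supported_on (int ` S)" for s
  proof -
    have "y * s \<in> supported_on {1..}"
      using y that by (rule supported_on_mult) auto
    then have "(y * s) $$ 0 = 0" by (rule supported_onD) simp
    then show ?thesis by auto
  qed
  then show "y \<in> nonunits (supported_on (int ` S))"
    using y by (auto simp: nonunits_def supported_on_def)
qed

section \<open>Type and reduced type of \<open>k[[S]]\<close>\<close>

text \<open>
  A series maps to the socle if and only if its exponents \<open>n\<close> satisfy \<open>n \<in> S\<close> and \<open>n + s \<in> m + S\<close> for all nonzero \<open>s \<in> S\<close>. Modulo
  \<open>t\<^sup>m k[[S]]\<close> only the exponents with \<open>n \<notin> m + S\<close> count, which says that \<open>n - m\<close> is a pseudo-Frobenius number.
\<close>

lemma cm_type_semigroup_ring: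
  assumes S: "numerical_semigroup S" "S \<noteq> UNIV"
  shows "cm_type (semigroup_ring S :: 'k::field fls set) (fls_X ^ sg_multiplicity S)
    = card (pseudo_frobenius S)"
proof -
  let ?m = "sg_multiplicity S" and ?R = "supported_on (int ` S) :: 'k fls set"
  let ?B = "(+) (int ?m) ` int ` S"
  define A where "A = {n \<in> int ` S. \<forall>s\<in>S - {0}. n + int s \<in> ?B}"
  have m: "?m \<in> S - {0}"
    using sg_multiplicity_in[OF S(1)] sg_multiplicity_pos[OF S(1)] by simp
  have "{r \<in> ?R. \<forall>y\<in>nonunits ?R. y * r \<in> principal_ideal ?R (fls_X ^ ?m)} = supported_on A"
    unfolding nonunits_semigroup_ring[OF S(1)] principal_ideal_supported_on
  proof (intro set_eqI iffI)
    fix r :: "'k fls"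
    assume r: "r \<in> {r \<in> ?R. \<forall>y\<in>supported_on (int ` (S - {0})). y * r \<in> supported_on ?B}"
    show "r \<in> supported_on A"
      unfolding supported_on_def
    proof (intro CollectI allI impI)
      fix n assume n: "r $$ n \<noteq> 0"
      have "n + int s \<in> ?B" if "s \<in> S - {0}" for s
      proof -
        have "(fls_X ^ s :: 'k fls) \<in> supported_on (int ` (S - {0}))"
          unfolding X_pow_in_supported_on using that by (rule imageI)
        then have "fls_X ^ s * r \<in> supported_on ?B" using r by blast
        moreover have "(fls_X ^ s * r) $$ (n + int s) \<noteq> 0"
          using n by (simp add: fls_X_power_times_conv_shift)
        ultimately show ?thesis by (auto simp only: supported_on_def)
      qed
      moreover have "n \<in> int ` S" using r n by (auto simp: supported_on_def)
      ultimately show "n \<in> A" by (simp add: A_def)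
    qed
  next
    fix r :: "'k fls" assume r: "r \<in> supported_on A"
    have "y * r \<in> supported_on ?B" if "y \<in> supported_on (int ` (S - {0}))" for y
      using that r
    proof (rule supported_on_mult)
      fix a b assume "a \<in> int ` (S - {0})" "b \<in> A"
      then show "a + b \<in> ?B" unfolding A_def by (auto simp only: add.commute[of a b] image_iff)
    qed
    moreover have "r \<in> ?R" using r by (auto simp: supported_on_def A_def)
    ultimately show "r \<in> {r \<in> ?R. \<forall>y\<in>supported_on (int ` (S - {0})). y * r \<in> supported_on ?B}"
      by blast
  qed
  then have "cm_type (semigroup_ring S :: 'k fls set) (fls_X ^ ?m)
      = quotient_dim fls_scale (supported_on A :: 'k fls set) (supported_on ?B)"
    by (simp only: cm_type_def semigroup_ring_eq_supported_on[OF S(1)] principal_ideal_supported_on)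
  moreover have "?B \<subseteq> A"
  proof
    fix n assume "n \<in> ?B"
    then obtain t where t: "t \<in> S" "n = int (?m + t)" by auto
    have "n + int s \<in> ?B" if "s \<in> S - {0}" for s
    proof -
      have "t + s \<in> S" using t(1) that numerical_semigroup_add[OF S(1)] by blast
      then have "int ?m + int (t + s) \<in> ?B" by (intro imageI)
      then show ?thesis using t(2) by (simp add: add.assoc)
    qed
    moreover have "n \<in> int ` S"
      unfolding t(2) using t(1) m numerical_semigroup_add[OF S(1)] by blast
    ultimately show "n \<in> A" by (simp add: A_def)
  qed
  moreover have AB: "A - ?B = (+) (int ?m) ` pseudo_frobenius S"
  proof (intro set_eqI iffI)
    fix n assume n: "n \<in> A - ?B"
    have "n - int ?m + int s \<in> int ` S" if "s \<in> S - {0}" for s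
    proof -
      have "n + int s \<in> ?B" using n that by (auto simp: A_def)
      then obtain t where "t \<in> int ` S" "n + int s = int ?m + t" by blast
      moreover from this have "n - int ?m + int s = t" by linarith
      ultimately show ?thesis by simp
    qed
    moreover have "n - int ?m \<notin> int ` S"
    proof
      assume "n - int ?m \<in> int ` S"
      then have "int ?m + (n - int ?m) \<in> ?B" by (rule imageI)
      then show False using n by simp
    qed
    ultimately have "n - int ?m \<in> pseudo_frobenius S" by (simp add: pseudo_frobenius_def)
    then have "int ?m + (n - int ?m) \<in> (+) (int ?m) ` pseudo_frobenius S" by (rule imageI)
    then show "n \<in> (+) (int ?m) ` pseudo_frobenius S" by simp
  next
    fix n assume "n \<in> (+) (int ?m) ` pseudo_frobenius S"
    then obtain f where f: "f \<in> pseudo_frobenius S" "n = int ?m + f" by blast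
    have "n \<in> int ` S" using f m by (auto simp: pseudo_frobenius_def add.commute)
    moreover have "n + int s \<in> ?B" if "s \<in> S - {0}" for s
    proof -
      have "f + int s \<in> int ` S" using f(1) that by (simp add: pseudo_frobenius_def)
      then have "int ?m + (f + int s) \<in> ?B" by (rule imageI)
      then show ?thesis using f(2) by (simp add: add.assoc)
    qed
    moreover have "n \<notin> ?B" using f by (auto simp: pseudo_frobenius_def)
    ultimately show "n \<in> A - ?B" by (simp add: A_def)
  qed
  ultimately show ?thesis
    using finite_pseudo_frobenius[OF S] by (simp add: quotient_dim_supported_on card_image)
qed

text \<open>
  The exponents in the conductor but outside \<open>m + S\<close> are the sums \<open>m + f\<close> of \<open>m\<close> and a gap \<open>f > F - m\<close>.
\<close>

lemma reduced_type_semigroup_ring: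
  assumes S: "numerical_semigroup S" "S \<noteq> UNIV"
  shows "reduced_type (semigroup_ring S :: 'k::field fls set) (fls_X ^ sg_multiplicity S)
    = card {f. f \<notin> int ` S \<and> frobenius S - int (sg_multiplicity S) < f}" (is "_ = card ?G")
proof -
  let ?m = "sg_multiplicity S"
  let ?B = "(+) (int ?m) ` int ` S"
  have "reduced_type (semigroup_ring S :: 'k fls set) (fls_X ^ ?m)
      = quotient_dim fls_scale (supported_on ({frobenius S<..} \<union> ?B) :: 'k fls set) (supported_on ?B)"
    by (simp only: reduced_type_def semigroup_ring_eq_supported_on[OF S(1)]
        conductor_semigroup_ring[OF S] principal_ideal_supported_on supported_on_sum)
  moreover have "({frobenius S<..} \<union> ?B) - ?B = (+) (int ?m) ` ?G"
  proof (intro set_eqI iffI)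
    fix n assume n: "n \<in> ({frobenius S<..} \<union> ?B) - ?B"
    have "n - int ?m \<notin> int ` S"
    proof
      assume "n - int ?m \<in> int ` S"
      then have "int ?m + (n - int ?m) \<in> ?B" by (rule imageI)
      then show False using n by simp
    qed
    moreover have "frobenius S < n" using n by blast
    ultimately have "n - int ?m \<in> ?G" by simp
    then have "int ?m + (n - int ?m) \<in> (+) (int ?m) ` ?G" by (rule imageI)
    then show "n \<in> (+) (int ?m) ` ?G" by simp
  qed auto
  moreover have "finite ?G"
    by (rule finite_subset[OF _ finite_pseudo_frobenius[OF S]])
      (use gap_near_frobenius_in_pseudo_frobenius[OF S] in blast)
  ultimately show ?thesis by (simp add: quotient_dim_supported_on card_image)
qed

text \<open>
  The two types are cardinalities of finite sets one of which contains the other, so they agree only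
  if the sets do.
\<close>

lemma maximal_reduced_type_iff:
  assumes S: "numerical_semigroup S" "S \<noteq> UNIV"
  shows "maximal_reduced_type TYPE('k::field) S \<longleftrightarrow>
    (\<forall>f\<in>pseudo_frobenius S. frobenius S - int (sg_multiplicity S) < f)"
proof -
  let ?G = "{f. f \<notin> int ` S \<and> frobenius S - int (sg_multiplicity S) < f}"
  have sub: "?G \<subseteq> pseudo_frobenius S"
    using gap_near_frobenius_in_pseudo_frobenius[OF S] by blast
  have "maximal_reduced_type TYPE('k) S \<longleftrightarrow> card ?G = card (pseudo_frobenius S)"
    unfolding maximal_reduced_type_def Let_def
    by (simp only: reduced_type_semigroup_ring[OF S] cm_type_semigroup_ring[OF S])
  also have "\<dots> \<longleftrightarrow> ?G = pseudo_frobenius S"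
    using card_subset_eq[OF finite_pseudo_frobenius[OF S] sub] by auto
  also have "\<dots> \<longleftrightarrow> (\<forall>f\<in>pseudo_frobenius S. frobenius S - int (sg_multiplicity S) < f)"
    using sub by (auto simp: pseudo_frobenius_def)
  finally show ?thesis .
qed

section \<open>Numerical duplication\<close>

context
  fixes S :: "nat set" and d :: nat and T :: "nat set"
  assumes S: "numerical_semigroup S" "S \<noteq> UNIV"
    and d: "d \<in> S" "odd d"
  defines "T \<equiv> numerical_duplication S (S - {0}) d"
begin

text \<open>
  As \<open>d\<close> is odd, the parts \<open>2 S\<close> and \<open>2 S\<^sup>* + d\<close> of \<open>T\<close> are separated by parity. Membership of an arbitrary
  integer in \<open>T\<close>, written as \<open>2 a\<close> or \<open>2 a + d\<close>, thereby becomes a question about \<open>a\<close> and \<open>S\<close>.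
\<close>

lemma even_in_duplication_iff: "2 * a \<in> int ` T \<longleftrightarrow> a \<in> int ` S"
proof
  assume "2 * a \<in> int ` T"
  then consider s where "s \<in> S" "2 * a = int (2 * s)" | e where "2 * a = int (2 * e + d)"
    unfolding T_def numerical_duplication_def by blast
  then show "a \<in> int ` S"
  proof cases
    case 2
    then have "even (2 * e + d)" by (metis dvd_triv_left even_of_nat)
    with d(2) show ?thesis by simp
  qed auto
next
  assume "a \<in> int ` S"
  then obtain s where "s \<in> S" "2 * a = int (2 * s)" by auto
  then show "2 * a \<in> int ` T" unfolding T_def numerical_duplication_def by blast
qed

lemma odd_in_duplication_iff: "2 * a + int d \<in> int ` T \<longleftrightarrow> a \<in> int ` S \<and> a \<noteq> 0"
proof
  assume "2 * a + int d \<in> int ` T"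
  then consider s where "2 * a + int d = int (2 * s)"
    | e where "e \<in> S - {0}" "2 * a + int d = int (2 * e + d)"
    unfolding T_def numerical_duplication_def by blast
  then show "a \<in> int ` S \<and> a \<noteq> 0"
  proof cases
    case 1
    then have "even (2 * a + int d)" by simp
    with d(2) show ?thesis by simp
  qed auto
next
  assume "a \<in> int ` S \<and> a \<noteq> 0"
  then obtain e where "e \<in> S - {0}" "2 * a + int d = int (2 * e + d)" by auto
  then show "2 * a + int d \<in> int ` T" unfolding T_def numerical_duplication_def by blast
qed

lemma even_or_odd_split: obtains a where "n = 2 * a" | a where "n = 2 * a + int d"
proof (cases "even n")
  case False
  then have "n = 2 * ((n - int d) div 2) + int d" using d(2) by simp
  then show ?thesis using that by blast
qed (use that in blast)

lemma greater_in_duplication: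
  assumes "2 * frobenius S + int d < n"
  shows "n \<in> int ` T"
  using even_or_odd_split[of n]
proof cases
  case (1 a)
  then have "a \<in> int ` S" using assms by (intro frobenius_less[OF S]) linarith
  then show ?thesis using 1 even_in_duplication_iff by simp
next
  case (2 a)
  then have "frobenius S < a" using assms by linarith
  then have "a \<in> int ` S" "a \<noteq> 0" using frobenius_less[OF S] frobenius_nonneg[OF S] by auto
  then show ?thesis using 2 odd_in_duplication_iff by simp
qed

lemma numerical_semigroup_duplication: "numerical_semigroup T"
proof -
  have zero: "0 \<in> T"
    using even_in_duplication_iff[of 0] S(1) by (auto simp: numerical_semigroup_def)
  have add: "x + y \<in> T" if "x \<in> T" "y \<in> T" for x y
  proof -
    have S_add: "a + b \<in> S" if "a \<in> S" "b \<in> S" for a b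
      using numerical_semigroup_add[OF S(1) that] .
    have even: "2 * s \<in> T" if "s \<in> S" for s
      using that by (auto simp: T_def numerical_duplication_def)
    have odd: "2 * e + d \<in> T" if "e \<in> S" "e \<noteq> 0" for e
      using that by (auto simp: T_def numerical_duplication_def)
    \<comment> \<open>A sum of two odd elements is \<open>2 (a + b + d)\<close>; here \<open>d \<in> S\<close> is used.\<close>
    from that consider
        a b where "a \<in> S" "b \<in> S" "x + y = 2 * (a + b)"
      | a b where "a \<in> S" "b \<in> S" "a + b \<noteq> 0" "x + y = 2 * (a + b) + d"
      | a b where "a \<in> S" "b \<in> S" "x + y = 2 * (a + b + d)"
      unfolding T_def numerical_duplication_def
      by (auto simp: algebra_simps)
    then show ?thesis
      by cases (metis even odd S_add d(1))+
  qed
  have "n \<in> T" if "2 * frobenius S + int d < int n" for n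
    using greater_in_duplication[OF that] by auto
  then have "UNIV - T \<subseteq> {..nat (2 * frobenius S + int d)}" by (force simp: not_less)
  then have "finite (UNIV - T)" by (rule finite_subset) simp
  then show ?thesis using zero add by (simp add: numerical_semigroup_def)
qed

lemma duplication_neq_UNIV: "T \<noteq> UNIV"
  using odd_in_duplication_iff[of 0] by auto

lemma frobenius_duplication: "frobenius T = 2 * frobenius S + int d"
proof (rule frobenius_eqI[OF numerical_semigroup_duplication duplication_neq_UNIV])
  show "2 * frobenius S + int d \<notin> int ` T"
    using odd_in_duplication_iff frobenius_notin[OF S] by blast
qed (rule greater_in_duplication)

lemma sg_multiplicity_duplication: "sg_multiplicity T = 2 * sg_multiplicity S"
  unfolding sg_multiplicity_def[of T]
proof (rule Least_equality)
  let ?m = "sg_multiplicity S"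
  show "2 * ?m \<in> T \<and> 2 * ?m \<noteq> 0"
    using sg_multiplicity_in[OF S(1)] sg_multiplicity_pos[OF S(1)]
    by (auto simp: T_def numerical_duplication_def)
  fix n assume "n \<in> T \<and> n \<noteq> 0"
  then obtain s where "s \<in> S" "s \<noteq> 0" "2 * s \<le> n"
    unfolding T_def numerical_duplication_def by fastforce
  then show "2 * ?m \<le> n" using sg_multiplicity_le[OF S(1), of s] by linarith
qed

text \<open>
  For \<open>g = 2 a\<close> the conditions on \<open>g\<close> in \<open>T\<close> amount to \<open>a + s \<in> S \<setminus> {0}\<close>, that is, to \<open>a \<in> PF(S)\<close>, because
  pseudo-Frobenius numbers of \<open>S\<close> are positive. For \<open>g = 2 a + d\<close> adding an odd element gives the
  condition \<open>a + s + d \<in> S\<close>, which follows from \<open>a + s \<in> S\<close> as \<open>d \<in> S\<close>; but \<open>g \<notin> T\<close> now also allows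
  \<open>a = 0\<close>, which contributes the extra number \<open>d\<close>.
\<close>

lemma pseudo_frobenius_duplication:
  "pseudo_frobenius T =
    (\<lambda>f. 2 * f) ` pseudo_frobenius S \<union> (\<lambda>f. 2 * f + int d) ` insert 0 (pseudo_frobenius S)"
proof -
  have shift: "(\<forall>t\<in>T - {0}. g + int t \<in> int ` T) \<longleftrightarrow>
      (\<forall>s\<in>S - {0}. g + 2 * int s \<in> int ` T \<and> g + (2 * int s + int d) \<in> int ` T)" for g
  proof -
    have "T - {0} = (\<lambda>s. 2 * s) ` (S - {0}) \<union> (\<lambda>e. 2 * e + d) ` (S - {0})"
      unfolding T_def numerical_duplication_def by auto
    then show ?thesis by (simp add: ball_Un image_Un ball_conj_distrib)
  qed
  have pos: "f > 0" if "f \<in> pseudo_frobenius S" for f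
    using pseudo_frobenius_bounds[OF S that] by simp
  have even: "2 * a \<in> pseudo_frobenius T \<longleftrightarrow> a \<in> pseudo_frobenius S" for a
  proof -
    have "2 * a \<in> pseudo_frobenius T \<longleftrightarrow> a \<notin> int ` S \<and>
        (\<forall>s\<in>S - {0}. 2 * (a + int s) \<in> int ` T \<and> 2 * (a + int s) + int d \<in> int ` T)"
      unfolding pseudo_frobenius_def mem_Collect_eq shift even_in_duplication_iff[of a]
      by (simp add: algebra_simps)
    also have "\<dots> \<longleftrightarrow> a \<in> pseudo_frobenius S"
      unfolding even_in_duplication_iff odd_in_duplication_iff
      using pos[of a] by (auto simp: pseudo_frobenius_def)
    finally show ?thesis .
  qed
  have odd: "2 * a + int d \<in> pseudo_frobenius T \<longleftrightarrow> a \<in> insert 0 (pseudo_frobenius S)" for a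
  proof -
    have "2 * a + int d \<in> pseudo_frobenius T \<longleftrightarrow> (a \<in> int ` S \<longrightarrow> a = 0) \<and>
        (\<forall>s\<in>S - {0}. 2 * (a + int s) + int d \<in> int ` T \<and> 2 * (a + int s + int d) \<in> int ` T)"
      unfolding pseudo_frobenius_def mem_Collect_eq shift odd_in_duplication_iff[of a]
      by (simp add: algebra_simps)
    also have "\<dots> \<longleftrightarrow> (a \<in> int ` S \<longrightarrow> a = 0) \<and> (\<forall>s\<in>S - {0}. a + int s \<in> int ` S \<and> a + int s \<noteq> 0)"
    proof -
      have "b + int d \<in> int ` S" if "b \<in> int ` S" for b
        using that d(1) numerical_semigroup_add[OF S(1)] by (auto simp flip: of_nat_add)
      then show ?thesis unfolding even_in_duplication_iff odd_in_duplication_iff by blast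
    qed
    also have "\<dots> \<longleftrightarrow> a \<in> insert 0 (pseudo_frobenius S)"
      using pos[of a] S(1) by (auto simp: pseudo_frobenius_def numerical_semigroup_def)
    finally show ?thesis .
  qed
  show ?thesis
  proof (intro set_eqI)
    fix g
    have "2 * a \<noteq> 2 * b + int d" for a b
      using d(2) by presburger
    then have parity: "2 * a \<notin> (\<lambda>f. 2 * f + int d) ` X" "2 * a + int d \<notin> (\<lambda>f. 2 * f) ` X" for a X
      unfolding image_iff by metis+
    show "g \<in> pseudo_frobenius T \<longleftrightarrow> g \<in> (\<lambda>f. 2 * f) ` pseudo_frobenius S
        \<union> (\<lambda>f. 2 * f + int d) ` insert 0 (pseudo_frobenius S)"
      using even_or_odd_split[of g]
    proof cases
      case (1 a)
      show ?thesis unfolding 1 Un_iff even by (simp only: parity) auto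
    next
      case (2 a)
      show ?thesis unfolding 2 Un_iff odd by (simp only: parity) auto
    qed
  qed
qed

text \<open>
  The numbers of \<open>PF(T)\<close> that can be minimal are \<open>d\<close> and \<open>2 min PF(S)\<close>; comparing each of them with
  \<open>F(T) - m(T)\<close> gives one conjunct.
\<close>

lemma maximal_reduced_type_duplication_iff:
  "maximal_reduced_type TYPE('k::field) T \<longleftrightarrow>
    frobenius S < int (sg_multiplicity S) \<and>
    2 * frobenius S + int d - 2 * int (sg_multiplicity S) < 2 * Min (pseudo_frobenius S)"
proof -
  let ?c = "2 * frobenius S + int d - 2 * int (sg_multiplicity S)"
  have fin: "finite (pseudo_frobenius S)" "pseudo_frobenius S \<noteq> {}"
    using finite_pseudo_frobenius[OF S] frobenius_in_pseudo_frobenius[OF S] by auto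
  have pos: "f > 0" if "f \<in> pseudo_frobenius S" for f
    using pseudo_frobenius_bounds[OF S that] by simp
  have "maximal_reduced_type TYPE('k) T \<longleftrightarrow> (\<forall>f\<in>pseudo_frobenius T. ?c < f)"
    unfolding maximal_reduced_type_iff[OF numerical_semigroup_duplication duplication_neq_UNIV]
    by (simp add: frobenius_duplication sg_multiplicity_duplication)
  also have "\<dots> \<longleftrightarrow> ?c < int d \<and> (\<forall>f\<in>pseudo_frobenius S. ?c < 2 * f)"
    unfolding pseudo_frobenius_duplication using pos by (force simp: ball_Un)
  also have "(\<forall>f\<in>pseudo_frobenius S. ?c < 2 * f) \<longleftrightarrow> ?c < 2 * Min (pseudo_frobenius S)"
    using Min_in[OF fin] Min_le[OF fin(1)] by force
  finally show ?thesis by simp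
qed

end

theorem proposition5p12:
  fixes S :: "nat set" and d :: nat
  assumes "numerical_semigroup S" and "S \<noteq> UNIV" and "d \<in> S" and "odd d"
  shows "(int d < 2 * Min (pseudo_frobenius S) \<longrightarrow>
           (maximal_reduced_type TYPE('k::{alg_closed_field, field_char_0})
              (numerical_duplication S (S - {0}) d)
            \<longleftrightarrow> int (sg_multiplicity S) > frobenius S)) \<and>
         (int d > 2 * Min (pseudo_frobenius S) \<longrightarrow>
           (maximal_reduced_type TYPE('k)
              (numerical_duplication S (S - {0}) d)
            \<longleftrightarrow> int (sg_multiplicity S) - frobenius S
                  \<ge> (int d + 1) div 2 - Min (pseudo_frobenius S)))"
proof -
  \<comment> \<open>In the first case the inequality for \<open>2 min PF(S)\<close> follows from \<open>F < m\<close>, in the second \<open>F < m\<close>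
    follows from it; with \<open>d = 2 k + 1\<close> it reads \<open>m - F > k - min PF(S)\<close> over the integers.\<close>
  obtain k where "d = 2 * k + 1" using assms(4) by (rule oddE)
  then show ?thesis
    unfolding maximal_reduced_type_duplication_iff[OF assms] by auto
qed

end
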